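(* Let $\Gamma$ be a finitely generated, infinite group, let $\mathcal G$ be the Cayley graph of $\Gamma$ with respect to a finite symmetric generating set and let $\rho:[0,\infty]\to[0,\infty]$ be a function with $\{\rho=0\}=\{0\}$. Consider the following conditions: (i) There exists an invariant action of $\Gamma$ on a space with measured walls $(X,\mathcal W,\mathcal B,\mu)$ with $\rho$-growth. (ii) There exists $C>0$ such that for every $\alpha<1$ there exists a $\Gamma$-invariant bond percolation $\mathbb P$ on $\mathcal G$ with $\mathbb E[\deg_\omega(o)]>\alpha\deg(o)$ and with $(C,\rho)$-exponential decay. Then condition (i) implies condition (ii).
   Context: Right Cayley graph: vertex set $\Gamma$, edge set $E=\{[g,gs]: g\in\Gamma, s\in S\}$ with $S$ a finite symmetric generating set; $o$ is the identity, $|g|$ the graph distance from $o$ to $g$, $\deg(o)$ the degree of $o$. $\Gamma$ acts by left multiplication. A $\Gamma$-invariant bond percolation is a probability measure $\mathbb P$ (expectation $\mathbb E$) on subsets $\omega\subset E$ invariant under $\Gamma$; clusters are connected components of $(\Gamma,\omega)$; $\deg_\omega(o)$ is the degree of $o$ in $\omega$; $\tau(g,h)=\mathbb P[g\leftrightarrow h]$ is the probability that $g,h$ are in the same cluster. It has $(C,\rho)$-exponential decay if there exist $\beta,\gamma>0$ with $\beta/\gamma\le C$ and $e^{-\beta|g|}\le\tau(o,g)\le e^{-\gamma\rho(|g|)}$ for all $g\in\Gamma$. A wall on a set $X$ is a partition of $X$ into two classes; it separates $x,y\in X$ if they lie in different classes. A space with measured walls is a 4-tuple $(X,\mathcal W,\mathcal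 B,\mu)$ with $\mathcal W$ a set of walls on $X$, $\mathcal B$ a $\sigma$-algebra on $\mathcal W$, $\mu$ a measure on $\mathcal B$, such that for all distinct $x,y\in X$ the set $\mathcal W(x,y)$ of walls in $\mathcal W$ separating $x$ and $y$ is in $\mathcal B$ and $w(x,y):=\mu(\mathcal W(x,y))<\infty$ (and $w(x,x)=0$). $\Gamma$ has an invariant action on it if $\Gamma$ acts on $X$ and the maps $\{B,B^c\}\mapsto\{gB,gB^c\}$ define a $\mathcal B$-measurable action of $\Gamma$ on $\mathcal W$ preserving $\mu$. The action has $\rho$-growth if for some $x_0\in X$, $w(x_0,gx_0)\ge\rho(|g|)$ for all $g\in\Gamma$. *)

theory Defs
  imports "HOL-Probability.Probability" "HOL-Algebra.Group_Action" "HOL-Algebra.Generated_Groups"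
begin

section \<open>Cayley graphs\<close>

text \<open>Edges are unordered, so an edge is the set of its endpoints.  If the identity happens to lie in
  \<open>S\<close>, it contributes one loop \<open>{g}\<close> at every vertex, which counts once in the degree.\<close>

definition cayley_edges :: "('g, 'b) monoid_scheme \<Rightarrow> 'g set \<Rightarrow> 'g set set" where
  "cayley_edges G S = {{g, g \<otimes>\<^bsub>G\<^esub> s} | g s. g \<in> carrier G \<and> s \<in> S}"

definition adj :: "'g set set \<Rightarrow> 'g rel" where
  "adj \<omega> = {(x, y). {x, y} \<in> \<omega>}"

definition same_cluster :: "'g set set \<Rightarrow> 'g \<Rightarrow> 'g \<Rightarrow> bool" where
  "same_cluster \<omega> x y \<longleftrightarrow> (x, y) \<in> (adj \<omega>)\<^sup>*"

definition degree_in :: "'g set set \<Rightarrow> 'g \<Rightarrow> nat" where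
  "degree_in \<omega> x = card {e \<in> \<omega>. x \<in> e}"

definition graph_dist :: "'g set set \<Rightarrow> 'g \<Rightarrow> 'g \<Rightarrow> nat" where
  "graph_dist E x y = (LEAST n. (x, y) \<in> adj E ^^ n)"

definition cayley_norm :: "('g, 'b) monoid_scheme \<Rightarrow> 'g set \<Rightarrow> 'g \<Rightarrow> nat" where
  "cayley_norm G S g = graph_dist (cayley_edges G S) \<one>\<^bsub>G\<^esub> g"


section \<open>Invariant bond percolation\<close>

text \<open>The \<open>\<sigma>\<close>-algebra on the subsets of \<open>E\<close> is the one generated by the events that a given
  edge is open, i.e. the product \<open>\<sigma>\<close>-algebra of \<open>{0,1}\<close> to the power \<open>E\<close>.  Translations are
  automatically measurable for it.\<close>

definition bond_percolation :: "'g set set \<Rightarrow> 'g set set measure \<Rightarrow> bool" where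
  "bond_percolation E P \<longleftrightarrow> prob_space P \<and> space P = Pow E \<and>
     sets P = sigma_sets (Pow E) {{\<omega> \<in> Pow E. e \<in> \<omega>} | e. e \<in> E}"

definition invariant_bond_percolation ::
    "('g, 'b) monoid_scheme \<Rightarrow> 'g set \<Rightarrow> 'g set set measure \<Rightarrow> bool" where
  "invariant_bond_percolation G S P \<longleftrightarrow> bond_percolation (cayley_edges G S) P \<and>
     (\<forall>g \<in> carrier G. distr P P (\<lambda>\<omega>. (\<lambda>e. (\<lambda>x. g \<otimes>\<^bsub>G\<^esub> x) ` e) ` \<omega>) = P)"

definition two_point :: "'g set set measure \<Rightarrow> 'g \<Rightarrow> 'g \<Rightarrow> real" where
  "two_point P g h = measure P {\<omega> \<in> space P. same_cluster \<omega> g h}"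

text \<open>The function \<open>t \<mapsto> exp (-t)\<close> on \<open>[0, \<infinity>]\<close>.\<close>

definition exp_neg :: "ennreal \<Rightarrow> real" where
  "exp_neg t = (if t = \<infinity> then 0 else exp (- enn2real t))"

definition exponential_decay ::
    "('g, 'b) monoid_scheme \<Rightarrow> 'g set \<Rightarrow> real \<Rightarrow> (ennreal \<Rightarrow> ennreal) \<Rightarrow> 'g set set measure \<Rightarrow> bool" where
  "exponential_decay G S C \<rho> P \<longleftrightarrow>
     (\<exists>\<beta> \<gamma> :: real. \<beta> > 0 \<and> \<gamma> > 0 \<and> \<beta> / \<gamma> \<le> C \<and>
        (\<forall>g \<in> carrier G.
           exp (- \<beta> * real (cayley_norm G S g)) \<le> two_point P \<one>\<^bsub>G\<^esub> g \<and>
           two_point P \<one>\<^bsub>G\<^esub> g \<le> exp_neg (ennreal \<gamma> * \<rho> (of_nat (cayley_norm G S g)))))"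


section \<open>Spaces with measured walls\<close>

definition wall_on :: "'x set \<Rightarrow> 'x set set \<Rightarrow> bool" where
  "wall_on X w \<longleftrightarrow> partition_on X w \<and> card w = 2"

definition separates :: "'x set set \<Rightarrow> 'x \<Rightarrow> 'x \<Rightarrow> bool" where
  "separates w x y \<longleftrightarrow> (\<exists>A\<in>w. \<exists>B\<in>w. A \<noteq> B \<and> x \<in> A \<and> y \<in> B)"

text \<open>The triple \<open>(\<W>, \<B>, \<mu>)\<close> is a single object \<open>M\<close> of type \<open>measure\<close>, with \<open>\<W> = space M\<close>,
  \<open>\<B> = sets M\<close> and \<open>\<mu> = emeasure M\<close>.\<close>

definition separating_walls :: "'x set set measure \<Rightarrow> 'x \<Rightarrow> 'x \<Rightarrow> 'x set set set" where
  "separating_walls M x y = {w \<in> space M. separates w x y}"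

definition wall_dist :: "'x set set measure \<Rightarrow> 'x \<Rightarrow> 'x \<Rightarrow> ennreal" where
  "wall_dist M x y = emeasure M (separating_walls M x y)"

definition measured_walls_space :: "'x set \<Rightarrow> 'x set set measure \<Rightarrow> bool" where
  "measured_walls_space X M \<longleftrightarrow>
     (\<forall>w \<in> space M. wall_on X w) \<and>
     (\<forall>x \<in> X. \<forall>y \<in> X. x \<noteq> y \<longrightarrow>
        separating_walls M x y \<in> sets M \<and> wall_dist M x y < \<infinity>)"

definition wall_map :: "('x \<Rightarrow> 'x) \<Rightarrow> 'x set set \<Rightarrow> 'x set set" where
  "wall_map f w = (\<lambda>B. f ` B) ` w"

definition invariant_wall_action ::
    "('g, 'b) monoid_scheme \<Rightarrow> 'x set \<Rightarrow> 'x set set measure \<Rightarrow> ('g \<Rightarrow> 'x \<Rightarrow> 'x) \<Rightarrow> bool" where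
  "invariant_wall_action G X M \<phi> \<longleftrightarrow> group_action G X \<phi> \<and>
     (\<forall>g \<in> carrier G. wall_map (\<phi> g) \<in> measurable M M \<and> distr M M (wall_map (\<phi> g)) = M)"

definition wall_growth ::
    "('g, 'b) monoid_scheme \<Rightarrow> 'g set \<Rightarrow> (ennreal \<Rightarrow> ennreal) \<Rightarrow> 'x set \<Rightarrow> 'x set set measure \<Rightarrow>
     ('g \<Rightarrow> 'x \<Rightarrow> 'x) \<Rightarrow> bool" where
  "wall_growth G S \<rho> X M \<phi> \<longleftrightarrow>
     (\<exists>x\<^sub>0 \<in> X. \<forall>g \<in> carrier G. \<rho> (of_nat (cayley_norm G S g)) \<le> wall_dist M x\<^sub>0 (\<phi> g x\<^sub>0))"

end

theory Submission
  imports Defs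
begin

text \<open>Take a Poisson process of walls of intensity \<open>c \<mu>\<close> and keep the edge \<open>[g, gs]\<close> if no wall of the
  process separates \<open>g x\<^sub>0\<close> from \<open>gs x\<^sub>0\<close>.  A finite set \<open>F\<close> of edges is kept with probability
  \<open>exp (- c \<mu>(W\<^sub>F))\<close>, where \<open>W\<^sub>F\<close> is the set of walls separating the endpoints of some edge of \<open>F\<close>.
  These probabilities determine the law, so it is invariant because \<open>\<mu>\<close> is.  With \<open>K\<close> a bound for
  \<open>w(x\<^sub>0, s x\<^sub>0)\<close>, \<open>s \<in> S\<close>, keeping a geodesic gives \<open>\<tau>(\<one>, g) \<ge> exp (- c K |g|)\<close>, while an open path
  from \<open>\<one>\<close> to \<open>g\<close> forces \<open>x\<^sub>0\<close> and \<open>g x\<^sub>0\<close> to be unseparated, so that \<open>\<tau>(\<one>, g) \<le> exp (- c w(x\<^sub>0, g x\<^sub>0))\<close>.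
  Hence \<open>\<beta> / \<gamma> = K\<close> for every \<open>c\<close>, and \<open>c \<rightarrow> 0\<close> makes the expected degree as large as desired.

  The measure \<open>\<mu>\<close> need not be \<open>\<sigma>\<close>-finite, but only the countable union of the finite-measure sets of
  walls separating two points of the orbit of \<open>x\<^sub>0\<close> matters.\<close>

section \<open>Random subsets avoiding a Poisson process\<close>

definition subset_algebra :: "'i set \<Rightarrow> 'i set measure" where
  "subset_algebra E = sigma (Pow E) {{\<omega> \<in> Pow E. e \<in> \<omega>} | e. e \<in> E}"

lemma space_subset_algebra [simp]: "space (subset_algebra E) = Pow E"
  by (simp add: subset_algebra_def space_measure_of_conv)

lemma sets_subset_algebra:
  "sets (subset_algebra E) = sigma_sets (Pow E) {{\<omega> \<in> Pow E. e \<in> \<omega>} | e. e \<in> E}"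
  unfolding subset_algebra_def by (rule sets_measure_of) auto

lemma sets_subset_algebra_mem:
  assumes "e \<in> E"
  shows "{\<omega> \<in> Pow E. e \<in> \<omega>} \<in> sets (subset_algebra E)"
  unfolding sets_subset_algebra using assms by (intro sigma_sets.Basic) blast

lemma sets_subset_algebra_superset:
  assumes "finite F" "F \<subseteq> E"
  shows "{\<omega> \<in> Pow E. F \<subseteq> \<omega>} \<in> sets (subset_algebra E)"
proof -
  have "{\<omega> \<in> space (subset_algebra E). \<forall>e\<in>F. e \<in> \<omega>} \<in> sets (subset_algebra E)"
    using assms sets_subset_algebra_mem[of _ E]
    by (intro sets.sets_Collect_finite_All) auto
  also have "{\<omega> \<in> space (subset_algebra E). \<forall>e\<in>F. e \<in> \<omega>} = {\<omega> \<in> Pow E. F \<subseteq> \<omega>}"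
    by auto
  finally show ?thesis .
qed

lemma measurable_subset_algebraI:
  assumes "\<And>x. x \<in> space M \<Longrightarrow> f x \<subseteq> E"
    and "\<And>e. e \<in> E \<Longrightarrow> {x \<in> space M. e \<in> f x} \<in> sets M"
  shows "f \<in> measurable M (subset_algebra E)"
  unfolding subset_algebra_def
proof (rule measurable_measure_of)
  fix A assume "A \<in> {{\<omega> \<in> Pow E. e \<in> \<omega>} | e. e \<in> E}"
  then obtain e where e: "e \<in> E" "A = {\<omega> \<in> Pow E. e \<in> \<omega>}" by blast
  then have "f -` A \<inter> space M = {x \<in> space M. e \<in> f x}"
    using assms(1) by auto
  with assms(2) e show "f -` A \<inter> space M \<in> sets M" by simp
qed (use assms(1) in auto)

text \<open>The events \<open>F \<subseteq> \<omega>\<close> with \<open>F\<close> finite generate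
  the sigma-algebra and are stable under intersection, two of them combining to the event of
  \<open>F \<union> F'\<close>. By the uniqueness theorem for pi-systems they determine a finite
  measure.\<close>

lemma subset_algebra_measure_eqI:
  assumes "sets P = sets (subset_algebra E)" "sets Q = sets (subset_algebra E)"
    and "finite_measure P"
    and eq: "\<And>F. finite F \<Longrightarrow> F \<subseteq> E \<Longrightarrow>
      emeasure P {\<omega> \<in> Pow E. F \<subseteq> \<omega>} = emeasure Q {\<omega> \<in> Pow E. F \<subseteq> \<omega>}"
  shows "P = Q"
proof -
  define \<A> where "\<A> = {{\<omega> \<in> Pow E. F \<subseteq> \<omega>} | F. finite F \<and> F \<subseteq> E}"
  have Pow_in: "Pow E \<in> \<A>"
    unfolding \<A>_def by (intro CollectI exI[of _ "{}"]) auto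
  have gen: "sets (subset_algebra E) = sigma_sets (Pow E) \<A>"
  proof
    show "sets (subset_algebra E) \<subseteq> sigma_sets (Pow E) \<A>"
      unfolding sets_subset_algebra
    proof (rule sigma_sets_mono)
      show "{{\<omega> \<in> Pow E. e \<in> \<omega>} | e. e \<in> E} \<subseteq> sigma_sets (Pow E) \<A>"
      proof clarify
        fix e assume "e \<in> E"
        then have "{\<omega> \<in> Pow E. e \<in> \<omega>} \<in> \<A>"
          unfolding \<A>_def by (intro CollectI exI[of _ "{e}"]) auto
        then show "{\<omega> \<in> Pow E. e \<in> \<omega>} \<in> sigma_sets (Pow E) \<A>" ..
      qed
    qed
    have "\<A> \<subseteq> sets (subset_algebra E)"
      unfolding \<A>_def using sets_subset_algebra_superset by blast
    then show "sigma_sets (Pow E) \<A> \<subseteq> sets (subset_algebra E)"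
      using sets.sigma_sets_subset[of \<A> "subset_algebra E"] by simp
  qed
  show ?thesis
  proof (rule measure_eqI_generator_eq[where E = \<A> and \<Omega> = "Pow E" and A = "\<lambda>_. Pow E"])
    show "Int_stable \<A>"
    proof (rule Int_stableI)
      fix A B assume "A \<in> \<A>" "B \<in> \<A>"
      then obtain F F' where "finite F" "F \<subseteq> E" "finite F'" "F' \<subseteq> E"
        "A = {\<omega> \<in> Pow E. F \<subseteq> \<omega>}" "B = {\<omega> \<in> Pow E. F' \<subseteq> \<omega>}"
        unfolding \<A>_def by blast
      then show "A \<inter> B \<in> \<A>"
        unfolding \<A>_def by (intro CollectI exI[of _ "F \<union> F'"]) auto
    qed
    show "\<A> \<subseteq> Pow (Pow E)" unfolding \<A>_def by auto
    show "emeasure P X = emeasure Q X" if "X \<in> \<A>" for X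
      using that eq unfolding \<A>_def by auto
    show "emeasure P (Pow E) \<noteq> \<infinity>"
      using assms(3) by (simp add: finite_measure.emeasure_finite)
  qed (use assms gen Pow_in in auto)
qed

text \<open>For a Poisson process and measurable sets \<open>W e\<close>, the set of those \<open>e\<close> for which \<open>W e\<close> contains no
  point has such a law, with \<open>a F\<close> the intensity of \<open>\<Union>e\<in>F. W e\<close>.\<close>

definition avoidance_law :: "'i set \<Rightarrow> ('i set \<Rightarrow> real) \<Rightarrow> 'i set measure \<Rightarrow> bool" where
  "avoidance_law E a P \<longleftrightarrow> prob_space P \<and> sets P = sets (subset_algebra E) \<and>
    (\<forall>F. finite F \<longrightarrow> F \<subseteq> E \<longrightarrow> emeasure P {\<omega> \<in> Pow E. F \<subseteq> \<omega>} = ennreal (exp (- a F)))"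

lemma avoidance_lawI:
  assumes "prob_space P" "sets P = sets (subset_algebra E)"
    and "\<And>F. finite F \<Longrightarrow> F \<subseteq> E \<Longrightarrow> emeasure P {\<omega> \<in> Pow E. F \<subseteq> \<omega>} = ennreal (exp (- a F))"
  shows "avoidance_law E a P"
  using assms by (simp add: avoidance_law_def)

lemma avoidance_lawD:
  assumes "avoidance_law E a P"
  shows "prob_space P" "sets P = sets (subset_algebra E)" "space P = Pow E"
    and "\<And>F. finite F \<Longrightarrow> F \<subseteq> E \<Longrightarrow> emeasure P {\<omega> \<in> Pow E. F \<subseteq> \<omega>} = ennreal (exp (- a F))"
proof -
  show "sets P = sets (subset_algebra E)"
    using assms by (simp add: avoidance_law_def)
  from sets_eq_imp_space_eq[OF this] show "space P = Pow E" by simp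
qed (use assms in \<open>simp_all add: avoidance_law_def\<close>)

lemma avoidance_law_measure:
  assumes "avoidance_law E a P" "finite F" "F \<subseteq> E"
  shows "measure P {\<omega> \<in> Pow E. F \<subseteq> \<omega>} = exp (- a F)"
  using avoidance_lawD(4)[OF assms] by (simp add: measure_def)

section \<open>Poisson samples, from a probability measure to a countable superposition\<close>

text \<open>Generating function of the Poisson law. With \<open>p\<close> the chance that one point
  misses a given set, this is the chance that a Poisson number of independent points all miss
  it.\<close>

lemma nn_integral_poisson_power:
  assumes "0 < r" "0 \<le> p"
  shows "(\<integral>\<^sup>+ j. ennreal p ^ j \<partial>measure_pmf (poisson_pmf r)) = ennreal (exp (- r * (1 - p)))"
proof -
  have s: "(\<lambda>j. exp (- r) * ((r * p) ^ j / fact j)) sums (exp (- r) * exp (r * p))"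
    using exp_converges[of "r * p"] by (intro sums_mult) (simp add: field_simps)
  have "(\<integral>\<^sup>+ j. ennreal p ^ j \<partial>measure_pmf (poisson_pmf r)) =
      (\<integral>\<^sup>+ j. ennreal (exp (- r) * ((r * p) ^ j / fact j)) \<partial>count_space UNIV)"
    unfolding nn_integral_measure_pmf using assms
    by (intro nn_integral_cong)
      (simp add: ennreal_power ennreal_mult[symmetric] power_mult_distrib)
  also have "\<dots> = ennreal (exp (- r) * exp (r * p))"
    unfolding nn_integral_count_space_nat using assms s
    by (intro suminf_ennreal_eq) auto
  also have "exp (- r) * exp (r * p) = exp (- r * (1 - p))"
    by (simp add: exp_add[symmetric] algebra_simps)
  finally show ?thesis .
qed

text \<open>Over a probability measure \<open>N\<close>, the Poisson process of intensity
  \<open>r N\<close> is a Poisson(\<open>r\<close>) number of independent points of law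
  \<open>N\<close>.\<close>

lemma poisson_subset_prob:
  fixes W :: "'i \<Rightarrow> 'w set"
  assumes "prob_space N" and W: "\<And>e. e \<in> E \<Longrightarrow> W e \<in> sets N" and r: "0 < r"
  shows "\<exists>R. avoidance_law E (\<lambda>F. r * measure N (\<Union>e\<in>F. W e)) R"
proof -
  interpret N: prob_space N by fact
  interpret Y: sequence_space N ..
  define Y where "Y = PiM (UNIV :: nat set) (\<lambda>_. N)"
  interpret Y': prob_space Y unfolding Y_def by (rule Y.prob_space_axioms)
  define \<Omega> where "\<Omega> = measure_pmf (poisson_pmf r) \<Otimes>\<^sub>M Y"
  interpret J: prob_space "measure_pmf (poisson_pmf r)" by (rule measure_pmf.prob_space_axioms)
  interpret JY: pair_prob_space "measure_pmf (poisson_pmf r)" Y ..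
  \<comment> \<open>In a sample \<open>(j, y)\<close> the number \<open>j\<close> says how many
    terms of the infinite sequence \<open>y\<close> count as points; an index is kept if none of
    these points hits its set.\<close>
  define f where "f = (\<lambda>(j :: nat, y :: nat \<Rightarrow> 'w). {e \<in> E. \<forall>k<j. y k \<notin> W e})"
  have space_Y: "space Y = {y. \<forall>k. y k \<in> space N}"
    unfolding Y_def by (auto simp: space_PiM PiE_def Pi_def extensional_def)
  have meas_Y: "{y \<in> space Y. y k \<in> A} \<in> sets Y" if "A \<in> sets N" for k A
    unfolding Y_def using that by measurable
  have sec: "{y \<in> space Y. \<forall>k<j. y k \<in> A} \<in> sets Y" if "A \<in> sets N" for j :: nat and A
    using meas_Y[OF that] by (intro sets.sets_Collect_countable_All sets.sets_Collect_imp) auto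
  have emY: "emeasure Y {y \<in> space Y. \<forall>k<j. y k \<in> A} = emeasure N A ^ j" if "A \<in> sets N" for j :: nat and A
    using Y.emeasure_PiM_Collect[of "{..<j}" "\<lambda>_. A"] that by (simp add: Y_def lessThan_iff Ball_def)
  \<comment> \<open>Splitting according to the number of points turns the event into a countable
    union of rectangles.\<close>
  have setB: "{x \<in> space \<Omega>. \<forall>k<fst x. snd x k \<in> A} \<in> sets \<Omega>" if A: "A \<in> sets N" for A
  proof -
    have "{x \<in> space \<Omega>. \<forall>k<fst x. snd x k \<in> A} =
        (\<Union>j. {j} \<times> {y \<in> space Y. \<forall>k<j. y k \<in> A})"
      by (auto simp: \<Omega>_def space_pair_measure)
    also have "\<dots> \<in> sets \<Omega>"
      unfolding \<Omega>_def by (intro sets.countable_UN'' pair_measureI sec[OF A]) auto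
    finally show ?thesis .
  qed
  have pre: "{x \<in> space \<Omega>. F \<subseteq> f x} = {x \<in> space \<Omega>. \<forall>k<fst x. snd x k \<in> space N - (\<Union>e\<in>F. W e)}"
    if "F \<subseteq> E" for F
    using that unfolding f_def \<Omega>_def space_pair_measure space_Y by auto
  have f: "f \<in> measurable \<Omega> (subset_algebra E)"
  proof (rule measurable_subset_algebraI)
    show "{x \<in> space \<Omega>. e \<in> f x} \<in> sets \<Omega>" if "e \<in> E" for e
      using pre[of "{e}"] setB[of "space N - W e"] W[OF that] that by simp
  qed (auto simp: f_def)
  have "prob_space (distr \<Omega> (subset_algebra E) f)"
    unfolding \<Omega>_def using f by (intro JY.prob_space_distr) (simp add: \<Omega>_def)
  moreover have "emeasure (distr \<Omega> (subset_algebra E) f) {\<omega> \<in> Pow E. F \<subseteq> \<omega>} =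
      ennreal (exp (- (r * measure N (\<Union>e\<in>F. W e))))" if F: "finite F" "F \<subseteq> E" for F
  proof -
    let ?U = "\<Union>e\<in>F. W e"
    have U: "?U \<in> sets N" using F W by auto
    let ?A = "space N - ?U"
    have A: "?A \<in> sets N" using U by auto
    have "emeasure (distr \<Omega> (subset_algebra E) f) {\<omega> \<in> Pow E. F \<subseteq> \<omega>} =
        emeasure \<Omega> (f -` {\<omega> \<in> Pow E. F \<subseteq> \<omega>} \<inter> space \<Omega>)"
      using f sets_subset_algebra_superset[OF F] by (rule emeasure_distr)
    also have "f -` {\<omega> \<in> Pow E. F \<subseteq> \<omega>} \<inter> space \<Omega> = {x \<in> space \<Omega>. \<forall>k<fst x. snd x k \<in> ?A}"
      using pre[OF F(2)] by (auto simp: f_def)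
    \<comment> \<open>Fubini: first fix the number \<open>j\<close> of points, for which the
      probability is a \<open>j\<close>-th power, then average over \<open>j\<close>.\<close>
    also have "emeasure \<Omega> \<dots> = (\<integral>\<^sup>+ j. emeasure Y (Pair j -` {x \<in> space \<Omega>. \<forall>k<fst x. snd x k \<in> ?A})
        \<partial>measure_pmf (poisson_pmf r))"
      unfolding \<Omega>_def using setB[OF A] by (intro Y'.emeasure_pair_measure_alt) (simp add: \<Omega>_def)
    also have "\<dots> = (\<integral>\<^sup>+ j. ennreal (measure N ?A) ^ j \<partial>measure_pmf (poisson_pmf r))"
    proof (rule nn_integral_cong)
      fix j
      have "Pair j -` {x \<in> space \<Omega>. \<forall>k<fst x. snd x k \<in> ?A} = {y \<in> space Y. \<forall>k<j. y k \<in> ?A}"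
        by (auto simp: \<Omega>_def space_pair_measure)
      then show "emeasure Y (Pair j -` {x \<in> space \<Omega>. \<forall>k<fst x. snd x k \<in> ?A}) = ennreal (measure N ?A) ^ j"
        by (simp only: emY[OF A] N.emeasure_eq_measure)
    qed
    also have "\<dots> = ennreal (exp (- r * (1 - measure N ?A)))"
      by (rule nn_integral_poisson_power[OF r measure_nonneg])
    also have "1 - measure N ?A = measure N ?U"
      using N.prob_compl[OF U] by simp
    finally show ?thesis by simp
  qed
  ultimately show ?thesis
    by (intro exI[of _ "distr \<Omega> (subset_algebra E) f"] avoidance_lawI) auto
qed

text \<open>Normalising \<open>M\<close> on \<open>D\<close> reduces to a probability measure; the
  Poisson parameter \<open>c * measure M D\<close> undoes the normalisation in the exponent.\<close>

lemma poisson_subset_finite: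
  fixes W :: "'i \<Rightarrow> 'w set"
  assumes W: "\<And>e. e \<in> E \<Longrightarrow> W e \<in> sets M" and D: "D \<in> sets M" "emeasure M D < \<infinity>"
    and c: "0 < c"
  shows "\<exists>R. avoidance_law E (\<lambda>F. c * measure M (D \<inter> (\<Union>e\<in>F. W e))) R"
proof (cases "emeasure M D = 0")
  case True
  have "measure M (D \<inter> A) = 0" for A
    using True D(1) by (metis Int_lower1 emeasure_mono le_zero_eq measure_def enn2real_0)
  then have "emeasure (return (subset_algebra E) E) {\<omega> \<in> Pow E. F \<subseteq> \<omega>} =
      ennreal (exp (- (c * measure M (D \<inter> (\<Union>e\<in>F. W e)))))" if "finite F" "F \<subseteq> E" for F
    using sets_subset_algebra_superset[OF that] that by simp
  moreover have "prob_space (return (subset_algebra E) E)"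
    by (rule prob_space_return) simp
  ultimately show ?thesis
    by (intro exI[of _ "return (subset_algebra E) E"] avoidance_lawI) auto
next
  case False
  define N where "N = uniform_measure M D"
  have "prob_space N"
    unfolding N_def using False D by (intro prob_space_uniform_measure) auto
  moreover have "W e \<in> sets N" if "e \<in> E" for e
    using W[OF that] by (simp add: N_def)
  moreover have pos: "0 < measure M D"
    using False D by (simp add: measure_def enn2real_positive_iff less_top zero_less_iff_neq_zero)
  then have "0 < c * measure M D" using c by simp
  ultimately obtain R where R: "avoidance_law E (\<lambda>F. c * measure M D * measure N (\<Union>e\<in>F. W e)) R"
    using poisson_subset_prob[of N E W "c * measure M D"] by blast
  have "c * measure M D * measure N (\<Union>e\<in>F. W e) = c * measure M (D \<inter> (\<Union>e\<in>F. W e))"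
    if "finite F" "F \<subseteq> E" for F
  proof -
    have "(\<Union>e\<in>F. W e) \<in> sets M" using that W by auto
    then show ?thesis
      unfolding N_def using False D pos by (subst measure_uniform_measure) auto
  qed
  then show ?thesis
    using R by (intro exI[of _ R]) (simp add: avoidance_law_def)
qed

text \<open>Superposition of independent processes: an index survives if every one of the
  independent samples keeps it. Probabilities multiply, so exponents add.\<close>

lemma avoidance_law_prod:
  fixes R :: "nat \<Rightarrow> 'i set measure"
  assumes law: "\<And>n. avoidance_law E (a n) (R n)"
    and sums: "\<And>F. finite F \<Longrightarrow> F \<subseteq> E \<Longrightarrow> (\<lambda>n. a n F) sums b F"
  shows "\<exists>P. avoidance_law E b P"
proof -
  note R = avoidance_lawD(1-3)[OF law] and em = avoidance_lawD(4)[OF law]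
  interpret R: prob_space "R n" for n by (rule R)
  interpret product_prob_space R "UNIV :: nat set" ..
  let ?Q = "PiM UNIV R"
  define f where "f = (\<lambda>x :: nat \<Rightarrow> 'i set. {e \<in> E. \<forall>n. e \<in> x n})"
  have meas: "{x \<in> space ?Q. F \<subseteq> x n} \<in> sets ?Q" if "finite F" "F \<subseteq> E" for n F
  proof -
    have "{\<omega> \<in> space (R n). F \<subseteq> \<omega>} \<in> sets (R n)"
      using sets_subset_algebra_superset[OF that] by (simp add: R(3) R(2))
    then show ?thesis by (intro sets_Collect_single') auto
  qed
  have f: "f \<in> measurable ?Q (subset_algebra E)"
  proof (rule measurable_subset_algebraI)
    fix e assume e: "e \<in> E"
    have "{x \<in> space ?Q. \<forall>n. {e} \<subseteq> x n} \<in> sets ?Q"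
      using meas[of "{e}"] e by (intro sets.sets_Collect_countable_All) auto
    then show "{x \<in> space ?Q. e \<in> f x} \<in> sets ?Q"
      using e by (simp add: f_def)
  qed (auto simp: f_def)
  have "emeasure (distr ?Q (subset_algebra E) f) {\<omega> \<in> Pow E. F \<subseteq> \<omega>} = ennreal (exp (- b F))"
    if F: "finite F" "F \<subseteq> E" for F
  proof -
    \<comment> \<open>\<open>B m\<close> constrains only the first \<open>m\<close> samples, so the
      finite product formula applies; these events decrease to the wanted one.\<close>
    define B where "B = (\<lambda>m. {x \<in> space ?Q. \<forall>n\<in>{..<m}. x n \<in> {\<omega> \<in> Pow E. F \<subseteq> \<omega>}})"
    have B_eq: "B m = {x \<in> space ?Q. \<forall>n\<in>{..<m}. F \<subseteq> x n}" for m
      by (auto simp: B_def space_PiM R(3) PiE_def Pi_def)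
    have Bs: "B m \<in> sets ?Q" for m
      unfolding B_eq using meas[OF F] by (intro sets.sets_Collect_finite_All) auto
    have emB: "emeasure ?Q (B m) = ennreal (exp (- (\<Sum>n<m. a n F)))" for m
    proof -
      have "emeasure ?Q (B m) = (\<Prod>n<m. emeasure (R n) {\<omega> \<in> Pow E. F \<subseteq> \<omega>})"
        unfolding B_def using sets_subset_algebra_superset[OF F] R(2)
        by (intro emeasure_PiM_Collect) auto
      also have "\<dots> = ennreal (exp (- (\<Sum>n<m. a n F)))"
        unfolding em[OF F] by (simp add: prod_ennreal exp_sum sum_negf[symmetric])
      finally show ?thesis .
    qed
    have "(\<lambda>m. emeasure ?Q (B m)) \<longlonglongrightarrow> emeasure ?Q (\<Inter>m. B m)"
      using Bs by (intro Lim_emeasure_decseq) (auto simp: decseq_def B_eq)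
    then have lim1: "(\<lambda>m. ennreal (exp (- (\<Sum>n<m. a n F)))) \<longlonglongrightarrow> emeasure ?Q (\<Inter>m. B m)"
      unfolding emB .
    have lim2: "(\<lambda>m. ennreal (exp (- (\<Sum>n<m. a n F)))) \<longlonglongrightarrow> ennreal (exp (- b F))"
      using sums[OF F] unfolding sums_def
      by (intro tendsto_ennrealI tendsto_exp tendsto_minus)
    have "emeasure ?Q (\<Inter>m. B m) = ennreal (exp (- b F))"
      by (rule LIMSEQ_unique[OF lim1 lim2])
    moreover have "f -` {\<omega> \<in> Pow E. F \<subseteq> \<omega>} \<inter> space ?Q = (\<Inter>m. B m)"
      using F(2) by (auto simp: B_eq f_def)
    ultimately show ?thesis
      using emeasure_distr[OF f sets_subset_algebra_superset[OF F]] by simp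
  qed
  moreover have "prob_space (distr ?Q (subset_algebra E) f)"
    using f by (rule P.prob_space_distr)
  ultimately show ?thesis
    by (intro exI[of _ "distr ?Q (subset_algebra E) f"] avoidance_lawI) auto
qed

text \<open>The countably many sets \<open>W e\<close> are made disjoint, an independent process of
  finite intensity is put on each piece, and the pieces are superposed. \<open>M\<close> itself may
  fail to be sigma-finite.\<close>

lemma poisson_subset_exists:
  fixes W :: "'i \<Rightarrow> 'w set"
  assumes E: "countable E" and W: "\<And>e. e \<in> E \<Longrightarrow> W e \<in> sets M"
    and fin: "\<And>e. e \<in> E \<Longrightarrow> emeasure M (W e) < \<infinity>" and c: "0 < c"
  shows "\<exists>P. avoidance_law E (\<lambda>F. c * measure M (\<Union>e\<in>F. W e)) P"
proof -
  \<comment> \<open>An empty \<open>E\<close> has no enumeration; the empty set is then the default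
    value.\<close>
  define V where "V = (\<lambda>n. if E = {} then {} else W (from_nat_into E n))"
  have V: "V n \<in> sets M" "emeasure M (V n) < \<infinity>" for n
    using W fin from_nat_into[of E n] by (auto simp: V_def)
  define D where "D = disjointed V"
  have D: "D n \<in> sets M" for n
    using V(1) sets.range_disjointed_sets[of V M] unfolding D_def by blast
  have Dfin: "emeasure M (D n) < \<infinity>" for n
    using V(2) emeasure_mono[OF disjointed_subset[of V n] V(1)[of n]]
    unfolding D_def by (meson le_less_trans)
  have "\<exists>R. avoidance_law E (\<lambda>F. c * measure M (D n \<inter> (\<Union>e\<in>F. W e))) R" for n
    using W D[of n] Dfin[of n] c by (rule poisson_subset_finite)
  then obtain R where R: "\<And>n. avoidance_law E (\<lambda>F. c * measure M (D n \<inter> (\<Union>e\<in>F. W e))) (R n)"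
    by metis
  \<comment> \<open>The pieces \<open>D n\<close> partition the union over \<open>F\<close>, which
    has finite measure, so countable additivity holds for the real-valued
    \<open>measure\<close>.\<close>
  have "(\<lambda>n. c * measure M (D n \<inter> (\<Union>e\<in>F. W e))) sums (c * measure M (\<Union>e\<in>F. W e))"
    if F: "finite F" "F \<subseteq> E" for F
  proof -
    let ?U = "\<Union>e\<in>F. W e"
    have U: "?U \<in> sets M" using F W by auto
    have "emeasure M ?U \<le> (\<Sum>e\<in>F. emeasure M (W e))"
      using F W by (intro emeasure_subadditive_finite) auto
    also have "\<dots> < \<infinity>" using F fin by (auto simp: less_top[symmetric] subset_iff)
    finally have Ufin: "emeasure M ?U \<noteq> \<infinity>" by simp
    have "?U \<subseteq> (\<Union>n. V n)"
    proof
      fix w assume "w \<in> ?U"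
      then obtain e where "e \<in> E" "w \<in> W e" using F by blast
      then show "w \<in> (\<Union>n. V n)"
        using from_nat_into_surj[OF E, of e] by (auto simp: V_def)
    qed
    then have eq: "(\<Union>n. D n \<inter> ?U) = ?U"
      unfolding D_def UN_disjointed_eq[of V, symmetric] by blast
    have "(\<lambda>n. measure M (D n \<inter> ?U)) sums measure M (\<Union>n. D n \<inter> ?U)"
    proof (rule measure_UNION)
      show "disjoint_family (\<lambda>n. D n \<inter> ?U)"
        using disjoint_family_disjointed[of V] unfolding D_def disjoint_family_on_def by blast
    qed (use D U Ufin eq in auto)
    then show ?thesis unfolding eq by (rule sums_mult)
  qed
  from avoidance_law_prod[OF R this] show ?thesis .
qed

section \<open>Walls\<close>

lemma separates_sym: "separates w x y \<longleftrightarrow> separates w y x"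
  unfolding separates_def by metis

lemma not_separates_self:
  assumes "wall_on X w"
  shows "\<not> separates w x x"
  using assms unfolding wall_on_def separates_def partition_on_def disjoint_def by blast

text \<open>The class of \<open>y\<close> differs from at least one of the two distinct classes
  containing \<open>x\<close> and \<open>z\<close>.\<close>

lemma separates_trans:
  assumes "wall_on X w" "y \<in> X" "separates w x z"
  shows "separates w x y \<or> separates w y z"
proof -
  obtain B where "B \<in> w" "y \<in> B"
    using assms(1,2) unfolding wall_on_def partition_on_def by blast
  then show ?thesis using assms(3) unfolding separates_def by metis
qed

lemma separates_wall_map:
  assumes "wall_on X w" "inj_on f X" "x \<in> X" "y \<in> X"
  shows "separates (wall_map f w) (f x) (f y) \<longleftrightarrow> separates w x y"
proof -
  have sub: "A \<subseteq> X" if "A \<in> w" for A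
    using assms(1) that unfolding wall_on_def partition_on_def by blast
  have "f ` A \<noteq> f ` B \<longleftrightarrow> A \<noteq> B" if "A \<in> w" "B \<in> w" for A B
    using inj_on_image_eq_iff[OF assms(2) sub[OF that(1)] sub[OF that(2)]] by simp
  moreover have "f z \<in> f ` A \<longleftrightarrow> z \<in> A" if "A \<in> w" "z \<in> X" for A z
    using inj_on_image_mem_iff[OF assms(2) that(2) sub[OF that(1)]] .
  ultimately show ?thesis
    using assms(3,4) unfolding separates_def wall_map_def by (simp cong: bex_cong)
qed

section \<open>Clusters and Cayley graphs\<close>

text \<open>Induction on the path length. Open edges lie inside \<open>V\<close>, so the last vertex
  before \<open>y\<close> ranges over a countable set.\<close>

lemma sets_relpow_adj:
  assumes V: "countable V" and E: "E \<subseteq> Pow V"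
  shows "{\<omega> \<in> Pow E. (x, y) \<in> adj \<omega> ^^ n} \<in> sets (subset_algebra E)"
proof (induction n arbitrary: y)
  case 0
  have "{\<omega> \<in> space (subset_algebra E). x = y} \<in> sets (subset_algebra E)"
    by (rule sets.sets_Collect_const)
  then show ?case by simp
next
  case (Suc n)
  have edge: "{\<omega> \<in> space (subset_algebra E). {z, y} \<in> \<omega>} \<in> sets (subset_algebra E)" for z
  proof (cases "{z, y} \<in> E")
    case True
    then show ?thesis using sets_subset_algebra_mem[OF True] by simp
  next
    case False
    then have "{\<omega> \<in> space (subset_algebra E). {z, y} \<in> \<omega>} = {}" by auto
    then show ?thesis by (simp only: sets.empty_sets)
  qed
  have "{\<omega> \<in> Pow E. (x, y) \<in> adj \<omega> ^^ Suc n} =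
      {\<omega> \<in> space (subset_algebra E). \<exists>z\<in>V. (x, z) \<in> adj \<omega> ^^ n \<and> {z, y} \<in> \<omega>}"
    using E by (auto simp: adj_def)
  also have "\<dots> \<in> sets (subset_algebra E)"
    using Suc edge by (intro sets.sets_Collect_countable_Ex'[OF _ V] sets.sets_Collect_conj) auto
  finally show ?case .
qed

lemma sets_same_cluster:
  assumes "countable V" "E \<subseteq> Pow V"
  shows "{\<omega> \<in> Pow E. same_cluster \<omega> x y} \<in> sets (subset_algebra E)"
proof -
  have "{\<omega> \<in> Pow E. same_cluster \<omega> x y} =
      {\<omega> \<in> space (subset_algebra E). \<exists>n. (x, y) \<in> adj \<omega> ^^ n}"
    by (auto simp: same_cluster_def rtrancl_is_UN_relpow)
  also have "\<dots> \<in> sets (subset_algebra E)"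
    using sets_relpow_adj[OF assms] by (intro sets.sets_Collect_countable_Ex) simp
  finally show ?thesis .
qed

section \<open>Countability, connectedness and degree of Cayley graphs\<close>

text \<open>Every element generated by \<open>S\<close> is the product of a finite word over
  \<open>S\<close> and its inverses, and there are countably many words.\<close>

lemma (in group) countable_generate:
  assumes "countable S" "S \<subseteq> carrier G"
  shows "countable (generate G S)"
proof -
  let ?S = "S \<union> m_inv G ` S"
  have S: "?S \<subseteq> carrier G" using assms by auto
  have closed: "foldr (\<otimes>) xs \<one> \<in> carrier G" if "xs \<in> lists ?S" for xs
    using that S by induction auto
  have mult: "foldr (\<otimes>) (xs @ ys) \<one> = foldr (\<otimes>) xs \<one> \<otimes> foldr (\<otimes>) ys \<one>"
    if "xs \<in> lists ?S" "ys \<in> lists ?S" for xs ys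
    using that(1)
  proof induction
    case Nil
    then show ?case using closed[OF that(2)] by simp
  next
    case (Cons a xs)
    then have "a \<in> carrier G" using S by blast
    then show ?case using Cons closed[OF that(2)] closed[of xs] by (simp add: m_assoc)
  qed
  have "g \<in> (\<lambda>xs. foldr (\<otimes>) xs \<one>) ` lists ?S" if "g \<in> generate G S" for g
    using that
  proof induction
    case one
    show ?case by (intro image_eqI[of _ _ "[]"]) auto
  next
    case (incl h)
    then show ?case using assms by (intro image_eqI[of _ _ "[h]"]) auto
  next
    case (inv h)
    then show ?case using assms by (intro image_eqI[of _ _ "[inv h]"]) auto
  next
    case (eng h1 h2)
    then obtain xs ys where xy: "xs \<in> lists ?S" "ys \<in> lists ?S"
      "h1 = foldr (\<otimes>) xs \<one>" "h2 = foldr (\<otimes>) ys \<one>"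
      by blast
    show ?case
      by (rule image_eqI[of _ _ "xs @ ys"]) (simp_all only: xy mult append_in_lists_conv simp_thms)
  qed
  then have "generate G S \<subseteq> (\<lambda>xs. foldr (\<otimes>) xs \<one>) ` lists ?S" by blast
  moreover have "countable (lists ?S)" using assms by (intro countable_lists) auto
  ultimately show ?thesis by (meson countable_image countable_subset)
qed

text \<open>The starting vertex \<open>x\<close> is arbitrary so that paths concatenate: a product
  is reached by a path for \<open>h1\<close> from \<open>x\<close> and then one for
  \<open>h2\<close> from \<open>x \<otimes> h1\<close>.\<close>

lemma (in group) cayley_edges_connected:
  assumes "S \<subseteq> carrier G" "\<And>s. s \<in> S \<Longrightarrow> inv s \<in> S" "g \<in> generate G S" "x \<in> carrier G"
  shows "(x, x \<otimes> g) \<in> (adj (cayley_edges G S))\<^sup>*"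
  using assms(3,4)
proof (induction arbitrary: x)
  case one
  then show ?case by simp
next
  case (incl h)
  then show ?case by (intro r_into_rtrancl) (auto simp: adj_def cayley_edges_def)
next
  case (inv h)
  then show ?case using assms(2) by (intro r_into_rtrancl) (auto simp: adj_def cayley_edges_def)
next
  case (eng h1 h2)
  have h: "h1 \<in> carrier G" "h2 \<in> carrier G"
    using eng.hyps generate_in_carrier[OF assms(1)] by auto
  have "(x, x \<otimes> h1) \<in> (adj (cayley_edges G S))\<^sup>*"
    using eng by simp
  also have "(x \<otimes> h1, x \<otimes> h1 \<otimes> h2) \<in> (adj (cayley_edges G S))\<^sup>*"
    using eng h by simp
  also have "x \<otimes> h1 \<otimes> h2 = x \<otimes> (h1 \<otimes> h2)" using eng h by (simp add: m_assoc)
  finally show ?case .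
qed

text \<open>Linearity of expectation: the degree is a finite sum of indicators of open
  edges.\<close>

lemma avoidance_law_expected_degree:
  assumes law: "avoidance_law E a P" and fin: "finite {e \<in> E. x \<in> e}"
  shows "(\<integral>\<omega>. real (degree_in \<omega> x) \<partial>P) = (\<Sum>e\<in>{e \<in> E. x \<in> e}. exp (- a {e}))"
proof -
  let ?A = "{e \<in> E. x \<in> e}"
  note P = avoidance_lawD(1-3)[OF law]
  interpret prob_space P by (rule P)
  have B: "{\<omega> \<in> Pow E. {e} \<subseteq> \<omega>} \<in> events" if "e \<in> ?A" for e
    unfolding P(2) using that by (intro sets_subset_algebra_superset) auto
  have "real (degree_in \<omega> x) = (\<Sum>e\<in>?A. indicator {\<omega> \<in> Pow E. {e} \<subseteq> \<omega>} \<omega>)" if "\<omega> \<in> space P" for \<omega>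
  proof -
    have "\<omega> \<subseteq> E" using that P(3) by simp
    then have "{e \<in> \<omega>. x \<in> e} = ?A \<inter> {e. e \<in> \<omega>}" by blast
    moreover have "(\<Sum>e\<in>?A. indicator {\<omega> \<in> Pow E. {e} \<subseteq> \<omega>} \<omega>) = (\<Sum>e\<in>?A. if e \<in> \<omega> then 1 else (0 :: real))"
      using \<open>\<omega> \<subseteq> E\<close> by (intro sum.cong) (auto simp: indicator_def)
    ultimately show ?thesis
      unfolding degree_in_def using fin by (simp add: sum.If_cases Int_def)
  qed
  then have "(\<integral>\<omega>. real (degree_in \<omega> x) \<partial>P) =
      (\<integral>\<omega>. (\<Sum>e\<in>?A. indicator {\<omega> \<in> Pow E. {e} \<subseteq> \<omega>} \<omega>) \<partial>P)"
    by (intro Bochner_Integration.integral_cong) auto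
  also have "\<dots> = (\<Sum>e\<in>?A. \<integral>\<omega>. indicator {\<omega> \<in> Pow E. {e} \<subseteq> \<omega>} \<omega> \<partial>P)"
    using B by (intro Bochner_Integration.integral_sum integrable_real_indicator) (auto simp: emeasure_eq_measure)
  also have "\<dots> = (\<Sum>e\<in>?A. exp (- a {e}))"
  proof (rule sum.cong[OF refl])
    fix e assume e: "e \<in> ?A"
    have "(\<integral>\<omega>. indicator {\<omega> \<in> Pow E. {e} \<subseteq> \<omega>} \<omega> \<partial>P) = prob {\<omega> \<in> Pow E. {e} \<subseteq> \<omega>}"
      using sets.sets_into_space[OF B[OF e]] by (simp add: Int_absorb2)
    also have "\<dots> = exp (- a {e})" using e by (intro avoidance_law_measure[OF law]) auto
    finally show "(\<integral>\<omega>. indicator {\<omega> \<in> Pow E. {e} \<subseteq> \<omega>} \<omega> \<partial>P) = exp (- a {e})" .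
  qed
  finally show ?thesis .
qed

text \<open>An edge \<open>{g, g \<otimes> s}\<close> through the identity has
  \<open>g = \<one>\<close> or \<open>g = inv s\<close>, so by symmetry of \<open>S\<close> it is
  \<open>{\<one>, t}\<close> with \<open>t\<close> in \<open>S\<close>. Finiteness ensures that
  \<open>card\<close> gives the true degree.\<close>

lemma (in group) finite_cayley_star:
  assumes "finite S" "S \<subseteq> carrier G" "\<And>s. s \<in> S \<Longrightarrow> inv s \<in> S"
  shows "finite {e \<in> cayley_edges G S. \<one> \<in> e}"
proof (rule finite_subset)
  show "{e \<in> cayley_edges G S. \<one> \<in> e} \<subseteq> (\<lambda>s. {\<one>, s}) ` S"
  proof clarify
    fix e assume "e \<in> cayley_edges G S" "\<one> \<in> e"
    then obtain g s where gs: "g \<in> carrier G" "s \<in> S" "e = {g, g \<otimes> s}" "\<one> = g \<or> \<one> = g \<otimes> s"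
      unfolding cayley_edges_def by blast
    have s: "s \<in> carrier G" using gs assms by auto
    from gs(4) show "e \<in> (\<lambda>s. {\<one>, s}) ` S"
    proof
      assume "\<one> = g"
      then have "e = {\<one>, s}" unfolding gs(3) using s by (metis l_one)
      then show ?thesis using gs by blast
    next
      assume "\<one> = g \<otimes> s"
      then have "g = inv s" using gs(1) s by (metis inv_equality)
      then have "e = {\<one>, inv s}" using gs(3) \<open>\<one> = g \<otimes> s\<close> by (metis doubleton_eq_iff)
      then show ?thesis using gs assms(3) by blast
    qed
  qed
qed (use assms in simp)

section \<open>Translations of edge configurations\<close>

abbreviation translate :: "('g, 'b) monoid_scheme \<Rightarrow> 'g \<Rightarrow> 'g set set \<Rightarrow> 'g set set" where
  "translate G g \<omega> \<equiv> (\<lambda>e. (\<lambda>x. g \<otimes>\<^bsub>G\<^esub> x) ` e) ` \<omega>"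

lemma (in group) cayley_edges_subset:
  assumes "S \<subseteq> carrier G"
  shows "cayley_edges G S \<subseteq> Pow (carrier G)"
  using assms by (auto simp: cayley_edges_def)

lemma (in group) translate_cayley_edges:
  assumes "S \<subseteq> carrier G" "g \<in> carrier G" "\<omega> \<subseteq> cayley_edges G S"
  shows "translate G g \<omega> \<subseteq> cayley_edges G S"
proof clarify
  fix e assume "e \<in> \<omega>"
  then obtain h s where "e = {h, h \<otimes> s}" "h \<in> carrier G" "s \<in> S"
    using assms(3) unfolding cayley_edges_def by blast
  moreover then have "(\<lambda>x. g \<otimes> x) ` e = {g \<otimes> h, (g \<otimes> h) \<otimes> s}"
    using assms by (auto simp: m_assoc)
  ultimately show "(\<lambda>x. g \<otimes> x) ` e \<in> cayley_edges G S"
    unfolding cayley_edges_def using assms by blast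
qed

lemma (in group) translate_inv:
  assumes "g \<in> carrier G" "\<omega> \<subseteq> Pow (carrier G)"
  shows "translate G (inv g) (translate G g \<omega>) = \<omega>"
proof -
  have "(\<lambda>x. inv g \<otimes> x) ` (\<lambda>x. g \<otimes> x) ` e = e" if "e \<in> \<omega>" for e
  proof -
    have "inv g \<otimes> (g \<otimes> x) = x" if "x \<in> e" for x
    proof -
      have "x \<in> carrier G" using assms(2) \<open>e \<in> \<omega>\<close> that by blast
      then show ?thesis using inv_solve_left'[of x g "g \<otimes> x"] assms(1) by simp
    qed
    then show ?thesis by (simp add: image_image)
  qed
  then show ?thesis by (simp add: image_image)
qed

text \<open>Moves the translation from the configuration to \<open>F\<close>, so that the preimage
  of an event \<open>F \<subseteq> \<omega>\<close> is again an event of this form.\<close>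

lemma (in group) subset_translate_iff:
  assumes "g \<in> carrier G" "\<omega> \<subseteq> Pow (carrier G)" "F \<subseteq> Pow (carrier G)"
  shows "F \<subseteq> translate G g \<omega> \<longleftrightarrow> translate G (inv g) F \<subseteq> \<omega>"
proof
  assume "F \<subseteq> translate G g \<omega>"
  then have "translate G (inv g) F \<subseteq> translate G (inv g) (translate G g \<omega>)"
    by (intro image_mono)
  then show "translate G (inv g) F \<subseteq> \<omega>" using translate_inv assms by simp
next
  assume "translate G (inv g) F \<subseteq> \<omega>"
  then have "translate G g (translate G (inv g) F) \<subseteq> translate G g \<omega>"
    by (intro image_mono)
  then show "F \<subseteq> translate G g \<omega>" using translate_inv[of "inv g"] assms by simp
qed

section \<open>Percolation from measured walls\<close>

locale pointed_wall_action = group_action G X \<phi>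
  for G :: "('g, 'b) monoid_scheme" (structure) and X :: "'x set" and \<phi> +
  fixes M :: "'x set set measure" and x0 :: 'x
  assumes walls: "measured_walls_space X M"
    and invariant: "invariant_wall_action G X M \<phi>"
    and base_point: "x0 \<in> X"
begin

sublocale group G by (rule group_hom.axioms(1)[OF group_hom])

text \<open>Quantifying over both endpoints makes the set depend on the unordered pair only, with no
  choice of orientation.\<close>

definition cut :: "'g set \<Rightarrow> 'x set set set" where
  "cut e = {w \<in> space M. \<exists>g\<in>e. \<exists>h\<in>e. separates w (\<phi> g x0) (\<phi> h x0)}"

lemma wall_on: "w \<in> space M \<Longrightarrow> wall_on X w"
  using walls by (simp add: measured_walls_space_def)

lemma orbit_in: "g \<in> carrier G \<Longrightarrow> \<phi> g x0 \<in> X"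
  using element_image base_point by blast

lemma cut_pair: "cut {g, h} = separating_walls M (\<phi> g x0) (\<phi> h x0)"
  using not_separates_self[OF wall_on] separates_sym[of _ "\<phi> h x0" "\<phi> g x0"]
  unfolding cut_def separating_walls_def by auto

lemma cut_singleton: "cut {g} = {}"
  using not_separates_self[OF wall_on] by (auto simp: cut_def)

lemma sets_cut_pair:
  assumes "g \<in> carrier G" "h \<in> carrier G"
  shows "cut {g, h} \<in> sets M" "emeasure M (cut {g, h}) < \<infinity>"
proof -
  have "cut {g, h} \<in> sets M \<and> emeasure M (cut {g, h}) < \<infinity>"
  \<comment> \<open>Measurability and finiteness are given for distinct points only. Different group
    elements may move \<open>x0\<close> to the same point, and then no wall separates.\<close>
  proof (cases "\<phi> g x0 = \<phi> h x0")
    case True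
    then have "cut {g, h} = {}"
      unfolding cut_pair separating_walls_def using not_separates_self[OF wall_on] by auto
    then show ?thesis by simp
  next
    case False
    then show ?thesis
      using walls orbit_in[OF assms(1)] orbit_in[OF assms(2)]
      unfolding cut_pair measured_walls_space_def wall_dist_def by blast
  qed
  then show "cut {g, h} \<in> sets M" "emeasure M (cut {g, h}) < \<infinity>" by auto
qed

text \<open>The triangle inequality at the level of sets of walls; it is what makes being
  unseparated transitive.\<close>

lemma cut_triangle:
  assumes "y \<in> carrier G"
  shows "cut {x, z} \<subseteq> cut {x, y} \<union> cut {y, z}"
  using separates_trans[OF wall_on orbit_in[OF assms]]
  unfolding cut_pair separating_walls_def by blast

text \<open>The action is injective on \<open>X\<close>, so it carries separation of two orbit
  points to separation of their translates and back. The preimage form fits invariance of the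
  measure, which is stated through \<open>distr\<close>.\<close>

lemma vimage_cut_translate:
  assumes g: "g \<in> carrier G" and e: "e \<subseteq> carrier G"
  shows "wall_map (\<phi> g) -` cut ((\<lambda>x. g \<otimes> x) ` e) \<inter> space M = cut e"
proof -
  have meas: "wall_map (\<phi> g) \<in> measurable M M"
    using invariant g by (simp add: invariant_wall_action_def)
  have "separates (wall_map (\<phi> g) w) (\<phi> (g \<otimes> a) x0) (\<phi> (g \<otimes> b) x0) \<longleftrightarrow>
      separates w (\<phi> a x0) (\<phi> b x0)" if "w \<in> space M" "a \<in> e" "b \<in> e" for w a b
  proof -
    have "a \<in> carrier G" "b \<in> carrier G" using that e by auto
    then show ?thesis
      using composition_rule[OF base_point g]
        separates_wall_map[OF wall_on[OF that(1)] inj_prop[OF g] orbit_in orbit_in] by simp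
  qed
  then have "wall_map (\<phi> g) w \<in> cut ((\<lambda>x. g \<otimes> x) ` e) \<longleftrightarrow> w \<in> cut e" if "w \<in> space M" for w
    using measurable_space[OF meas that] that unfolding cut_def by (simp cong: bex_cong)
  moreover have "cut e \<subseteq> space M" by (auto simp: cut_def)
  ultimately show ?thesis by blast
qed

lemma emeasure_cut_translate:
  assumes g: "g \<in> carrier G" and F: "F \<subseteq> Pow (carrier G)"
    and sets: "(\<Union>e\<in>translate G g F. cut e) \<in> sets M"
  shows "emeasure M (\<Union>e\<in>translate G g F. cut e) = emeasure M (\<Union>e\<in>F. cut e)"
proof -
  have meas: "wall_map (\<phi> g) \<in> measurable M M" and eq: "distr M M (wall_map (\<phi> g)) = M"
    using invariant g by (simp_all add: invariant_wall_action_def)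
  have "emeasure M (\<Union>e\<in>translate G g F. cut e) =
      emeasure (distr M M (wall_map (\<phi> g))) (\<Union>e\<in>translate G g F. cut e)"
    by (simp only: eq)
  also have "\<dots> = emeasure M (wall_map (\<phi> g) -` (\<Union>e\<in>translate G g F. cut e) \<inter> space M)"
    using meas sets by (rule emeasure_distr)
  also have "wall_map (\<phi> g) -` (\<Union>e\<in>translate G g F. cut e) \<inter> space M =
      (\<Union>e\<in>F. wall_map (\<phi> g) -` cut ((\<lambda>x. g \<otimes> x) ` e) \<inter> space M)"
    by auto
  also have "\<dots> = (\<Union>e\<in>F. cut e)"
    using vimage_cut_translate[OF g] F by (intro SUP_cong) auto
  finally show ?thesis .
qed

section \<open>Almost sure transitivity of being unseparated\<close>

text \<open>All pairs of vertices, adjacent or not, with \<open>g = h\<close> allowed, so that a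
  random subset can be read as a reflexive symmetric relation on the group.\<close>

definition vertex_pairs :: "'g set set" where
  "vertex_pairs = {{g, h} | g h. g \<in> carrier G \<and> h \<in> carrier G}"

lemma countable_vertex_pairs:
  assumes "countable (carrier G)"
  shows "countable vertex_pairs"
proof -
  have "vertex_pairs = (\<lambda>(g, h). {g, h}) ` (carrier G \<times> carrier G)"
    by (auto simp: vertex_pairs_def)
  then show ?thesis using assms by auto
qed

lemma sets_cut:
  assumes "e \<in> vertex_pairs"
  shows "cut e \<in> sets M" "emeasure M (cut e) < \<infinity>"
  using assms sets_cut_pair unfolding vertex_pairs_def by auto

lemma cayley_edges_vertex_pairs:
  assumes "S \<subseteq> carrier G"
  shows "cayley_edges G S \<subseteq> vertex_pairs"
  using assms unfolding cayley_edges_def vertex_pairs_def by blast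

text \<open>By \<open>cut_triangle\<close>, adding the pair \<open>{x, z}\<close> does not enlarge
  the union of cuts. Hence requiring it as well leaves the probability unchanged, and the difference
  of the two events is null. Only the law enters, not its construction.\<close>

lemma AE_pair_transitive:
  assumes law: "avoidance_law vertex_pairs (\<lambda>F. c * measure M (\<Union>e\<in>F. cut e)) P"
    and xyz: "x \<in> carrier G" "y \<in> carrier G" "z \<in> carrier G"
  shows "AE \<omega> in P. {x, y} \<in> \<omega> \<longrightarrow> {y, z} \<in> \<omega> \<longrightarrow> {x, z} \<in> \<omega>"
proof -
  note P = avoidance_lawD(1,2)[OF law] and space = avoidance_lawD(3)[OF law] and em = avoidance_lawD(4)[OF law]
  interpret prob_space P by (rule P)
  define A where "A = (\<lambda>F. {\<omega> \<in> Pow vertex_pairs. F \<subseteq> \<omega>})"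
  let ?F = "{{x, y}, {y, z}}" and ?F' = "{{x, y}, {y, z}, {x, z}}"
  have sub: "?F' \<subseteq> vertex_pairs" "?F \<subseteq> vertex_pairs"
    using xyz unfolding vertex_pairs_def by blast+
  have meas: "A ?F' \<in> sets P" "A ?F \<in> sets P"
    using sub unfolding A_def P(2) by (intro sets_subset_algebra_superset; simp)+
  have "(\<Union>e\<in>?F'. cut e) = (\<Union>e\<in>?F. cut e)"
    using cut_triangle[OF xyz(2), of x z] by auto
  then have "emeasure P (A ?F') = emeasure P (A ?F)"
    unfolding A_def using sub by (simp only: em finite.emptyI finite_insert)
  moreover have "A ?F' \<subseteq> A ?F" by (auto simp: A_def)
  ultimately have "emeasure P (A ?F - A ?F') = 0"
    using meas by (subst emeasure_Diff) (auto simp: emeasure_eq_measure)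
  then have "A ?F - A ?F' \<in> null_sets P" using meas by auto
  then show ?thesis
    by (rule AE_I') (auto simp: A_def space)
qed

text \<open>As the group is countable, transitivity holds almost surely for all \<open>y\<close> and
  \<open>z\<close> at once; induction along an open path then links \<open>x\<close> to its endpoint
  directly.\<close>

lemma AE_cluster_pair:
  assumes law: "avoidance_law vertex_pairs (\<lambda>F. c * measure M (\<Union>e\<in>F. cut e)) P"
    and V: "countable (carrier G)" and x: "x \<in> carrier G"
  shows "AE \<omega> in P. \<forall>y. same_cluster \<omega> x y \<longrightarrow> {x, y} \<in> \<omega>"
proof -
  note P = avoidance_lawD(1,2)[OF law] and space = avoidance_lawD(3)[OF law] and em = avoidance_lawD(4)[OF law]
  interpret prob_space P by (rule P)
  have xx: "{{x, x}} \<subseteq> vertex_pairs" using x unfolding vertex_pairs_def by blast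
  \<comment> \<open>Start of the induction, the path of length zero: the cut of
    \<open>{x, x}\<close> is empty, so the exponent is 0.\<close>
  have "prob {\<omega> \<in> Pow vertex_pairs. {{x, x}} \<subseteq> \<omega>} = 1"
    using avoidance_law_measure[OF law _ xx] by (simp add: cut_singleton)
  from AE_prob_1[OF this] have "AE \<omega> in P. {x, x} \<in> \<omega> \<and> \<omega> \<subseteq> vertex_pairs"
    by eventually_elim auto
  moreover have "AE \<omega> in P. \<forall>y\<in>carrier G. \<forall>z\<in>carrier G. {x, y} \<in> \<omega> \<longrightarrow> {y, z} \<in> \<omega> \<longrightarrow> {x, z} \<in> \<omega>"
    using AE_pair_transitive[OF law x] unfolding AE_ball_countable[OF V] by blast
  ultimately show ?thesis
  proof eventually_elim
    case (elim \<omega>)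
    show ?case
    proof (intro allI impI)
      fix y assume "same_cluster \<omega> x y"
      then show "{x, y} \<in> \<omega>"
        unfolding same_cluster_def
      proof (induction rule: rtrancl_induct)
        case base
        then show ?case using elim by simp
      next
        case (step y z)
        then have "{y, z} \<in> \<omega>" by (simp add: adj_def)
        moreover from this have "y \<in> carrier G" "z \<in> carrier G"
          using elim unfolding vertex_pairs_def by (auto simp: doubleton_eq_iff subset_iff)
        ultimately show ?case using elim step by blast
      qed
    qed
  qed
qed

text \<open>The upper bound goes through the random set of all unseparated pairs, of which the percolation
  is the trace on the Cayley edges: almost surely being unseparated is transitive, so that an open
  path from \<open>\<one>\<close> to \<open>g\<close> forces the pair \<open>{\<one>, g}\<close> to be unseparated.\<close>

lemma wall_percolation_exists:
  assumes V: "countable (carrier G)" and S: "S \<subseteq> carrier G" and c: "0 < c"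
  shows "\<exists>P. avoidance_law (cayley_edges G S) (\<lambda>F. c * measure M (\<Union>e\<in>F. cut e)) P \<and>
    (\<forall>g\<in>carrier G. two_point P \<one> g \<le> exp (- (c * measure M (cut {\<one>, g}))))"
proof -
  let ?E = "cayley_edges G S"
  have E: "?E \<subseteq> vertex_pairs" "?E \<subseteq> Pow (carrier G)"
    using cayley_edges_vertex_pairs[OF S] cayley_edges_subset[OF S] by auto
  have "\<exists>Q. avoidance_law vertex_pairs (\<lambda>F. c * measure M (\<Union>e\<in>F. cut e)) Q"
    using countable_vertex_pairs[OF V] sets_cut c by (rule poisson_subset_exists)
  then obtain Q where law: "avoidance_law vertex_pairs (\<lambda>F. c * measure M (\<Union>e\<in>F. cut e)) Q" ..
  note Q = avoidance_lawD(1,2)[OF law] and space = avoidance_lawD(3)[OF law] and em = avoidance_lawD(4)[OF law]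
  interpret Q: prob_space Q by (rule Q)
  have res: "(\<lambda>\<omega>. \<omega> \<inter> ?E) \<in> measurable Q (subset_algebra ?E)"
  proof (rule measurable_subset_algebraI)
    fix e assume e: "e \<in> ?E"
    then have "{\<omega> \<in> space Q. e \<in> \<omega> \<inter> ?E} = {\<omega> \<in> Pow vertex_pairs. e \<in> \<omega>}"
      by (auto simp: space)
    then show "{\<omega> \<in> space Q. e \<in> \<omega> \<inter> ?E} \<in> sets Q"
      using sets_subset_algebra_mem[of e vertex_pairs] e E Q(2) by auto
  qed simp
  define P where "P = distr Q (subset_algebra ?E) (\<lambda>\<omega>. \<omega> \<inter> ?E)"
  have P: "prob_space P" unfolding P_def using res by (rule Q.prob_space_distr)
  have emP: "emeasure P {\<omega> \<in> Pow ?E. F \<subseteq> \<omega>} = ennreal (exp (- (c * measure M (\<Union>e\<in>F. cut e))))"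
    if F: "finite F" "F \<subseteq> ?E" for F
  proof -
    have "emeasure P {\<omega> \<in> Pow ?E. F \<subseteq> \<omega>} =
        emeasure Q ((\<lambda>\<omega>. \<omega> \<inter> ?E) -` {\<omega> \<in> Pow ?E. F \<subseteq> \<omega>} \<inter> space Q)"
      unfolding P_def using res sets_subset_algebra_superset[OF F] by (rule emeasure_distr)
    also have "(\<lambda>\<omega>. \<omega> \<inter> ?E) -` {\<omega> \<in> Pow ?E. F \<subseteq> \<omega>} \<inter> space Q = {\<omega> \<in> Pow vertex_pairs. F \<subseteq> \<omega>}"
      using F(2) by (auto simp: space)
    finally show ?thesis using em[OF F(1)] F(2) E(1) by simp
  qed
  have "two_point P \<one> g \<le> exp (- (c * measure M (cut {\<one>, g})))" if g: "g \<in> carrier G" for g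
  proof -
    let ?B = "{\<omega> \<in> Pow vertex_pairs. {{\<one>, g}} \<subseteq> \<omega>}"
    have sub: "{{\<one>, g}} \<subseteq> vertex_pairs" using g unfolding vertex_pairs_def by blast
    have B: "?B \<in> sets Q" using sets_subset_algebra_superset[OF _ sub] Q(2) by simp
    have "two_point P \<one> g = measure P {\<omega> \<in> Pow ?E. same_cluster \<omega> \<one> g}"
      unfolding two_point_def P_def by simp
    also have "\<dots> = measure Q ((\<lambda>\<omega>. \<omega> \<inter> ?E) -` {\<omega> \<in> Pow ?E. same_cluster \<omega> \<one> g} \<inter> space Q)"
      unfolding P_def using res sets_same_cluster[OF V E(2)] by (rule measure_distr)
    also have "\<dots> \<le> measure Q ?B"
    proof (rule Q.finite_measure_mono_AE[OF _ B])
      \<comment> \<open>Opening further pairs only enlarges clusters, so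
        \<open>AE_cluster_pair\<close> for the full set of pairs controls the clusters of its
        trace.\<close>
      have mono: "same_cluster \<omega> \<one> g" if "same_cluster (\<omega> \<inter> ?E) \<one> g" for \<omega>
        using that rtrancl_mono[of "adj (\<omega> \<inter> ?E)" "adj \<omega>"]
        unfolding same_cluster_def adj_def by auto
      from AE_cluster_pair[OF law V one_closed]
      show "AE \<omega> in Q. \<omega> \<in> (\<lambda>\<omega>. \<omega> \<inter> ?E) -` {\<omega> \<in> Pow ?E. same_cluster \<omega> \<one> g} \<inter> space Q \<longrightarrow> \<omega> \<in> ?B"
        by eventually_elim (use mono in \<open>auto simp: space\<close>)
    qed
    also have "measure Q ?B = exp (- (c * measure M (cut {\<one>, g})))"
      using avoidance_law_measure[OF law _ sub] by simp
    finally show ?thesis .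
  qed
  moreover have "sets P = sets (subset_algebra ?E)" by (simp add: P_def)
  ultimately show ?thesis using P emP by (intro exI[of _ P] conjI avoidance_lawI) auto
qed

text \<open>Translation by \<open>g\<close> replaces a finite \<open>F\<close> by its translate
  under \<open>inv g\<close> in the probability of \<open>F \<subseteq> \<omega>\<close>, and
  invariance of the wall measure makes both exponents equal. These probabilities determine the
  law.\<close>

lemma wall_percolation_invariant:
  assumes S: "S \<subseteq> carrier G" and law: "avoidance_law (cayley_edges G S) (\<lambda>F. c * measure M (\<Union>e\<in>F. cut e)) P"
  shows "invariant_bond_percolation G S P"
proof -
  let ?E = "cayley_edges G S"
  note P = avoidance_lawD(1,2)[OF law] and space = avoidance_lawD(3)[OF law] and em = avoidance_lawD(4)[OF law]
  interpret prob_space P by (rule P)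
  have E: "?E \<subseteq> vertex_pairs" "?E \<subseteq> Pow (carrier G)"
    using cayley_edges_vertex_pairs[OF S] cayley_edges_subset[OF S] by auto
  have "distr P P (translate G g) = P" if g: "g \<in> carrier G" for g
  proof -
    have sub: "translate G g \<omega> \<subseteq> ?E" if "\<omega> \<subseteq> ?E" for \<omega>
      using translate_cayley_edges[OF S g that] .
    have iff: "F \<subseteq> translate G g \<omega> \<longleftrightarrow> translate G (inv g) F \<subseteq> \<omega>" if "F \<subseteq> ?E" "\<omega> \<subseteq> ?E" for F \<omega>
      using subset_translate_iff[OF g order_trans[OF that(2) E(2)] order_trans[OF that(1) E(2)]] .
    have trF: "translate G (inv g) F \<subseteq> ?E" if "F \<subseteq> ?E" for F
      using translate_cayley_edges[OF S inv_closed[OF g] that] .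
    have pre: "translate G g -` {\<omega> \<in> Pow ?E. F \<subseteq> \<omega>} \<inter> space P =
        {\<omega> \<in> Pow ?E. translate G (inv g) F \<subseteq> \<omega>}" if F: "F \<subseteq> ?E" for F
    proof (rule Set.set_eqI)
      fix \<omega>
      show "\<omega> \<in> translate G g -` {\<omega> \<in> Pow ?E. F \<subseteq> \<omega>} \<inter> space P \<longleftrightarrow>
          \<omega> \<in> {\<omega> \<in> Pow ?E. translate G (inv g) F \<subseteq> \<omega>}"
        unfolding space Int_iff vimage_eq mem_Collect_eq Pow_iff
        by (cases "\<omega> \<subseteq> ?E") (simp_all only: sub iff[OF F] simp_thms)
    qed
    have "translate G g \<in> measurable P (subset_algebra ?E)"
    proof (rule measurable_subset_algebraI)
      show "translate G g \<omega> \<subseteq> ?E" if "\<omega> \<in> space P" for \<omega>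
        using sub that space by simp
      show "{\<omega> \<in> space P. e \<in> translate G g \<omega>} \<in> sets P" if e: "e \<in> ?E" for e
      proof -
        have eE: "{e} \<subseteq> ?E" using e by simp
        have "{\<omega> \<in> space P. e \<in> translate G g \<omega>} = {\<omega> \<in> space P. {e} \<subseteq> translate G g \<omega>}"
          by (simp only: insert_subset empty_subsetI simp_thms)
        also have "\<dots> = {\<omega> \<in> Pow ?E. translate G (inv g) {e} \<subseteq> \<omega>}"
          unfolding space by (intro Collect_cong conj_cong refl iff eE) (simp only: Pow_iff)
        also have "\<dots> \<in> sets P"
          unfolding P(2) using trF[OF eE] by (intro sets_subset_algebra_superset) auto
        finally show ?thesis .
      qed
    qed
    then have meas: "translate G g \<in> measurable P P"
      using measurable_cong_sets[OF refl P(2)] by blast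
    show ?thesis
    proof (rule subset_algebra_measure_eqI[where E = ?E])
      show "finite_measure (distr P P (translate G g))"
        using prob_space.finite_measure[OF prob_space_distr[OF meas]] .
      fix F assume F: "finite F" "F \<subseteq> ?E"
      have FM: "(\<Union>e\<in>F'. cut e) \<in> sets M" if "finite F'" "F' \<subseteq> ?E" for F'
        using that sets_cut E(1) by blast
      have "emeasure (distr P P (translate G g)) {\<omega> \<in> Pow ?E. F \<subseteq> \<omega>} =
          emeasure P (translate G g -` {\<omega> \<in> Pow ?E. F \<subseteq> \<omega>} \<inter> space P)"
        using meas sets_subset_algebra_superset[OF F] P(2) by (intro emeasure_distr) auto
      also have "\<dots> = ennreal (exp (- (c * measure M (\<Union>e\<in>translate G (inv g) F. cut e))))"
        unfolding pre[OF F(2)] by (rule em[OF finite_imageI[OF F(1)] trF[OF F(2)]])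
      \<comment> \<open>Here the invariance of the wall measure enters.\<close>
      also have "measure M (\<Union>e\<in>translate G (inv g) F. cut e) = measure M (\<Union>e\<in>F. cut e)"
        unfolding measure_def
        using emeasure_cut_translate[OF inv_closed[OF g] order_trans[OF F(2) E(2)]
          FM[OF finite_imageI[OF F(1)] trF[OF F(2)]]] by (simp only:)
      also have "ennreal (exp (- (c * measure M (\<Union>e\<in>F. cut e)))) = emeasure P {\<omega> \<in> Pow ?E. F \<subseteq> \<omega>}"
        using em[OF F] by simp
      finally show "emeasure (distr P P (translate G g)) {\<omega> \<in> Pow ?E. F \<subseteq> \<omega>} =
        emeasure P {\<omega> \<in> Pow ?E. F \<subseteq> \<omega>}" .
    qed (simp_all add: P(2))
  qed
  then show ?thesis
    unfolding invariant_bond_percolation_def bond_percolation_def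
    using P space by (simp add: sets_subset_algebra)
qed

section \<open>Lower bound for the two-point function\<close>

text \<open>An edge is a translate of some \<open>{\<one>, s}\<close>, so its cut has the measure of
  one of the summands. The sum over \<open>S\<close> serves as a uniform bound in place of a
  maximum.\<close>

lemma measure_cut_edge:
  assumes S: "finite S" "S \<subseteq> carrier G" and e: "e \<in> cayley_edges G S"
  shows "measure M (cut e) \<le> (\<Sum>s\<in>S. measure M (cut {\<one>, s}))"
proof -
  obtain g s where gs: "g \<in> carrier G" "s \<in> S" "e = {g, g \<otimes> s}"
    using e unfolding cayley_edges_def by blast
  have s: "s \<in> carrier G" using gs S by auto
  have "translate G g {{\<one>, s}} = {e}" using gs by simp
  moreover have "cut e \<in> sets M"
    using sets_cut cayley_edges_vertex_pairs[OF S(2)] e by blast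
  ultimately have "emeasure M (cut e) = emeasure M (cut {\<one>, s})"
    using emeasure_cut_translate[OF gs(1), of "{{\<one>, s}}"] s by simp
  then have "measure M (cut e) = measure M (cut {\<one>, s})" by (simp add: measure_def)
  also have "\<dots> \<le> (\<Sum>s\<in>S. measure M (cut {\<one>, s}))"
    using gs(2) S(1) by (intro member_le_sum) auto
  finally show ?thesis .
qed

lemma measure_cut_UN_le:
  assumes S: "finite S" "S \<subseteq> carrier G" and F: "finite F" "F \<subseteq> cayley_edges G S"
  shows "measure M (\<Union>e\<in>F. cut e) \<le> real (card F) * (\<Sum>s\<in>S. measure M (cut {\<one>, s}))"
proof -
  have "measure M (\<Union>e\<in>F. cut e) \<le> (\<Sum>e\<in>F. measure M (cut e))"
    using F cayley_edges_vertex_pairs[OF S(2)] sets_cut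
    by (intro measure_UNION_le) auto
  also have "\<dots> \<le> (\<Sum>e\<in>F. \<Sum>s\<in>S. measure M (cut {\<one>, s}))"
    using F measure_cut_edge[OF S] by (intro sum_mono) auto
  finally show ?thesis by simp
qed

text \<open>All edges of a geodesic are open together with the stated probability at least, because
  the measure of the union of their cuts is at most the sum of the measures.\<close>

lemma wall_percolation_two_point_ge:
  assumes S: "finite S" "S \<subseteq> carrier G" and V: "countable (carrier G)" and c: "0 < c"
    and law: "avoidance_law (cayley_edges G S) (\<lambda>F. c * measure M (\<Union>e\<in>F. cut e)) P"
    and g: "(\<one>, g) \<in> (adj (cayley_edges G S))\<^sup>*"
  shows "exp (- (c * (\<Sum>s\<in>S. measure M (cut {\<one>, s})) * real (cayley_norm G S g))) \<le> two_point P \<one> g"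
proof -
  let ?E = "cayley_edges G S" and ?K = "\<Sum>s\<in>S. measure M (cut {\<one>, s})" and ?n = "cayley_norm G S g"
  note P = avoidance_lawD(1-3)[OF law]
  interpret prob_space P by (rule P)
  \<comment> \<open>Connectedness guarantees that the \<open>LEAST\<close> in
    \<open>graph_dist\<close> is attained, giving a path with exactly
    \<open>cayley_norm G S g\<close> steps.\<close>
  have "\<exists>n. (\<one>, g) \<in> adj ?E ^^ n" using g by (simp add: rtrancl_is_UN_relpow)
  then have "(\<one>, g) \<in> adj ?E ^^ ?n"
    unfolding cayley_norm_def graph_dist_def by (rule LeastI_ex)
  then obtain f where f: "f 0 = \<one>" "f ?n = g" "\<And>i. i < ?n \<Longrightarrow> {f i, f (Suc i)} \<in> ?E"
    unfolding relpow_fun_conv adj_def by auto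
  define F where "F = (\<lambda>i. {f i, f (Suc i)}) ` {..<?n}"
  have F: "finite F" "F \<subseteq> ?E" using f(3) by (auto simp: F_def)
  have card: "card F \<le> ?n" unfolding F_def using card_image_le[of "{..<?n}"] by simp
  have K: "0 \<le> ?K" by (simp add: sum_nonneg)
  have "measure M (\<Union>e\<in>F. cut e) \<le> real (card F) * ?K"
    using measure_cut_UN_le[OF S F] .
  also have "\<dots> \<le> real ?n * ?K" using card K by (intro mult_right_mono) auto
  finally have "exp (- (c * ?K * real ?n)) \<le> exp (- (c * measure M (\<Union>e\<in>F. cut e)))"
    using c by (simp add: mult.assoc mult.commute[of ?K])
  also have "\<dots> = prob {\<omega> \<in> Pow ?E. F \<subseteq> \<omega>}"
    using avoidance_law_measure[OF law F] by simp
  also have "\<dots> \<le> prob {\<omega> \<in> Pow ?E. same_cluster \<omega> \<one> g}"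
  proof (rule finite_measure_mono)
    have "same_cluster \<omega> \<one> g" if "F \<subseteq> \<omega>" for \<omega>
    proof -
      have "(\<one>, g) \<in> adj \<omega> ^^ ?n"
        unfolding relpow_fun_conv using f(1,2) that
        by (intro exI[of _ f]) (auto simp: F_def adj_def)
      then show ?thesis unfolding same_cluster_def by (rule relpow_imp_rtrancl)
    qed
    then show "{\<omega> \<in> Pow ?E. F \<subseteq> \<omega>} \<subseteq> {\<omega> \<in> Pow ?E. same_cluster \<omega> \<one> g}" by blast
    show "{\<omega> \<in> Pow ?E. same_cluster \<omega> \<one> g} \<in> events"
      unfolding P(2) by (rule sets_same_cluster[OF V cayley_edges_subset[OF S(2)]])
  qed
  finally show ?thesis unfolding two_point_def P(3) .
qed

end

section \<open>Choice of the intensity and conclusion\<close>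

text \<open>Passage from real to extended exponents: \<open>r\<close> lies below the finite
  \<open>t\<close>, so the infinite case of \<open>exp_neg\<close> does not occur.\<close>

lemma exp_neg_ge_exp:
  assumes "0 < c" "r \<le> t" "t < \<infinity>"
  shows "exp (- (c * enn2real t)) \<le> exp_neg (ennreal c * r)"
proof -
  have "r < \<infinity>" using assms(2,3) by (rule le_less_trans)
  then have "ennreal c * r \<noteq> \<infinity>" by (simp add: ennreal_mult_eq_top_iff)
  moreover have "enn2real (ennreal c * r) = c * enn2real r"
    using assms(1) by (simp add: enn2real_mult)
  moreover have "enn2real r \<le> enn2real t"
    using assms(2,3) by (intro enn2real_mono) auto
  ultimately show ?thesis using assms(1) by (simp add: exp_neg_def)
qed

theorem corollary3p8:
  fixes G :: "('g, 'b) monoid_scheme" and S :: "'g set" and \<rho> :: "ennreal \<Rightarrow> ennreal"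
  assumes "group G"
    and "infinite (carrier G)"
    and "finite S" and "S \<subseteq> carrier G" and "\<forall>s \<in> S. inv\<^bsub>G\<^esub> s \<in> S"
    and "generate G S = carrier G"
    and "{r. \<rho> r = 0} = {0}"
    and "\<exists>(X :: 'x set) M \<phi>. measured_walls_space X M \<and> invariant_wall_action G X M \<phi> \<and>
           wall_growth G S \<rho> X M \<phi>"
  shows "\<exists>C > 0. \<forall>\<alpha> < (1 :: real). \<exists>P. invariant_bond_percolation G S P \<and>
           (\<integral>\<omega>. real (degree_in \<omega> \<one>\<^bsub>G\<^esub>) \<partial>P) > \<alpha> * real (degree_in (cayley_edges G S) \<one>\<^bsub>G\<^esub>) \<and>
           exponential_decay G S C \<rho> P"
proof -
  obtain X :: "'x set" and M \<phi> x0 where W: "measured_walls_space X M" "invariant_wall_action G X M \<phi>"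
    and x0: "x0 \<in> X"
    and growth: "\<And>g. g \<in> carrier G \<Longrightarrow> \<rho> (of_nat (cayley_norm G S g)) \<le> wall_dist M x0 (\<phi> g x0)"
    using assms(8) unfolding wall_growth_def by blast
  interpret pointed_wall_action G X \<phi> M x0
    using W x0 by (intro pointed_wall_action.intro pointed_wall_action_axioms.intro)
      (auto simp: invariant_wall_action_def)
  let ?E = "cayley_edges G S" and ?A = "{e \<in> cayley_edges G S. \<one>\<^bsub>G\<^esub> \<in> e}"
  define L where "L = (\<Sum>s\<in>S. measure M (cut {\<one>\<^bsub>G\<^esub>, s}))"
  \<comment> \<open>Adding 1 gives at once the strict positivity needed for the decay constant and
    for the division defining \<open>c\<close>. \<open>K\<close> is fixed before
    \<open>\<alpha>\<close>.\<close>
  define K where "K = L + 1"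
  have L: "0 \<le> L" unfolding L_def by (simp add: sum_nonneg)
  then have K: "0 < K" by (simp add: K_def)
  have V: "countable (carrier G)"
    using countable_generate[of S] assms(3,4,6) by (simp add: countable_finite)
  have conn: "(\<one>\<^bsub>G\<^esub>, g) \<in> (adj ?E)\<^sup>*" if "g \<in> carrier G" for g
    using cayley_edges_connected[of S g "\<one>\<^bsub>G\<^esub>"] assms(4,5,6) that by simp
  have finA: "finite ?A" using assms(5) by (intro finite_cayley_star assms(3,4)) blast
  \<comment> \<open>An infinite group needs a generator, so the identity has positive degree; this
    keeps the degree inequality strict.\<close>
  have "S \<noteq> {}"
  proof
    assume "S = {}"
    then have "carrier G = {\<one>\<^bsub>G\<^esub>}" using assms(6) generate_empty by simp
    then show False using assms(2) by (metis finite.emptyI finite_insert)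
  qed
  then obtain s where "s \<in> S" by blast
  then have "{\<one>\<^bsub>G\<^esub>, \<one>\<^bsub>G\<^esub> \<otimes>\<^bsub>G\<^esub> s} \<in> ?A" unfolding cayley_edges_def by blast
  then have deg: "0 < card ?A" using finA card_gt_0_iff by blast
  show ?thesis
  proof (intro exI[of _ K] conjI allI impI K)
    fix \<alpha> :: real assume \<alpha>: "\<alpha> < 1"
    \<comment> \<open>Then \<open>c * K\<close> is half of \<open>1 - \<alpha>\<close>, and
      \<open>exp (- (c * K)) \<ge> 1 - c * K > \<alpha>\<close>.\<close>
    define c where "c = (1 - \<alpha>) / (2 * K)"
    have c: "0 < c" using \<alpha> K by (simp add: c_def)
    have "\<alpha> < 1 - c * K" using \<alpha> K by (simp add: c_def field_simps)
    also have "\<dots> \<le> exp (- (c * K))" using exp_ge_add_one_self[of "- (c * K)"] by simp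
    finally have exp_gt: "\<alpha> < exp (- (c * K))" .
    obtain P where law: "avoidance_law ?E (\<lambda>F. c * measure M (\<Union>e\<in>F. cut e)) P"
      and upper: "\<And>g. g \<in> carrier G \<Longrightarrow> two_point P \<one>\<^bsub>G\<^esub> g \<le> exp (- (c * measure M (cut {\<one>\<^bsub>G\<^esub>, g})))"
      using wall_percolation_exists[OF V assms(4) c] by blast
    \<comment> \<open>Each edge at the identity is open with probability at least
      \<open>exp (- (c * K))\<close>, which exceeds \<open>\<alpha>\<close>.\<close>
    have "\<alpha> * real (card ?A) < exp (- (c * K)) * real (card ?A)"
      using exp_gt deg by simp
    also have "\<dots> = (\<Sum>e\<in>?A. exp (- (c * K)))" by simp
    also have "\<dots> \<le> (\<Sum>e\<in>?A. exp (- (c * measure M (cut e))))"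
    proof (rule sum_mono)
      fix e assume "e \<in> ?A"
      then have "measure M (cut e) \<le> K"
        using measure_cut_edge[OF assms(3,4)] by (fastforce simp: K_def L_def)
      then show "exp (- (c * K)) \<le> exp (- (c * measure M (cut e)))" using c by simp
    qed
    also have "\<dots> = (\<integral>\<omega>. real (degree_in \<omega> \<one>\<^bsub>G\<^esub>) \<partial>P)"
      using avoidance_law_expected_degree[OF law finA] by simp
    finally have degree: "\<alpha> * real (degree_in ?E \<one>\<^bsub>G\<^esub>) < (\<integral>\<omega>. real (degree_in \<omega> \<one>\<^bsub>G\<^esub>) \<partial>P)"
      by (simp add: degree_in_def)
    have "exp (- (c * K) * real (cayley_norm G S g)) \<le> two_point P \<one>\<^bsub>G\<^esub> g" if g: "g \<in> carrier G" for g
    proof -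
      have "exp (- (c * K) * real (cayley_norm G S g)) \<le> exp (- (c * L * real (cayley_norm G S g)))"
        using c by (simp add: K_def mult_right_mono)
      also have "\<dots> \<le> two_point P \<one>\<^bsub>G\<^esub> g"
        unfolding L_def by (rule wall_percolation_two_point_ge[OF assms(3,4) V c law conn[OF g]])
      finally show ?thesis .
    qed
    moreover have "two_point P \<one>\<^bsub>G\<^esub> g \<le> exp_neg (ennreal c * \<rho> (of_nat (cayley_norm G S g)))"
      if g: "g \<in> carrier G" for g
    proof -
      \<comment> \<open>The identity acts as the identity map restricted to \<open>X\<close>, so the
        cut of \<open>{\<one>, g}\<close> is measured by the wall distance occurring in the growth
        condition.\<close>
      have "\<phi> \<one>\<^bsub>G\<^esub> x0 = x0" using id_eq_one x0 by (metis restrict_apply')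
      then have dist: "emeasure M (cut {\<one>\<^bsub>G\<^esub>, g}) = wall_dist M x0 (\<phi> g x0)"
        by (simp add: cut_pair wall_dist_def)
      have "exp (- (c * enn2real (wall_dist M x0 (\<phi> g x0)))) \<le> exp_neg (ennreal c * \<rho> (of_nat (cayley_norm G S g)))"
        using c growth[OF g] sets_cut_pair(2)[OF one_closed g] unfolding dist by (rule exp_neg_ge_exp)
      then show ?thesis
        using upper[OF g] by (simp add: measure_def dist)
    qed
    \<comment> \<open>The rates are \<open>c * K\<close> and \<open>c\<close>; their ratio
      \<open>K\<close> is the same for every \<open>\<alpha>\<close>.\<close>
    ultimately have "exponential_decay G S K \<rho> P"
      unfolding exponential_decay_def using c K
      by (intro exI[of _ "c * K"] exI[of _ c]) simp
    then show "\<exists>P. invariant_bond_percolation G S P \<and>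
        \<alpha> * real (degree_in ?E \<one>\<^bsub>G\<^esub>) < (\<integral>\<omega>. real (degree_in \<omega> \<one>\<^bsub>G\<^esub>) \<partial>P) \<and>
        exponential_decay G S K \<rho> P"
      using wall_percolation_invariant[OF assms(4) law] degree by blast
  qed
qed

end
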